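(* Let $E$ be the Fréchet space of $1$-periodic smooth functions $x:\mathbb R\to\mathbb R$, let $\varphi:\mathbb R\to\mathbb R$ be smooth and $1$-periodic, and let $n\in\mathbb Z\setminus\{0\}$ be fixed. Let $$U=\{x\in E : 0<\inf\{|n+x'(s)| : s\in\mathbb R\}\},$$ and let $f:U\to E$ be given by $$f(x)(s)=\varphi(ns+x(s))\,(n+x'(s))\qquad(x\in U,\ s\in\mathbb R).$$ Suppose that there exists some $x$ at which the map $f:E\supseteq U\to E$ is almost M-tame. Then the range of $\varphi$ is a singleton, i.e. $\varphi$ is constant.
   Context: Fréchet space: a complete metrizable real locally convex space. The space $E$ of $1$-periodic smooth functions (those with $x(s+1)=x(s)$ for all $s$) carries its usual topology, defined by the norms $p_i(u)=\sup\{|u^{(l)}(s)| : s\in\mathbb R,\ 0\le l\le i\}$, $i=0,1,2,\dots$. P-norm: for a Fréchet space $E$, a P-norm for $E$ is any function $\varrho:E\to\mathbb R$ such that $(x,y)\mapsto\varrho(x-y)$ is a metric on $E$ defining the topology of $E$. Directional derivative: for Fréchet spaces $E,F$ and a function $f:E\supseteq\operatorname{dom} f\to F$, $\delta f(x,u)=\lim_{t\to0}t^{-1}(f(x+tu)-f(x))$ (limit in $F$) denotes the derivative of $f$ at $x\in\operatorname{dom} f$ in the direction $u\in E$. Almost M-tame: a directionally differentiable map $f:E\supseteq\operatorname{dom} f\to F$ between Fréchet spaces is called almost M-tame at $x$ iff there are P-norms $\varrho_1$ for $E$ and $\varrho_2$ for $F$ such that for all $z,u\in E$ with $\varrho_1(z)\le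 1$ we have $x+z\in\operatorname{dom} f$ and $\varrho_2(\delta f(x+z,u)-\delta f(x,u))\le\varrho_1(u)$. The domain $\operatorname{dom} f$ is $U$ here. (The choice $z=0$ forces $x\in U$.) *)

theory Defs
  imports "HOL-Analysis.Analysis"
begin

section \<open>Smooth and 1-periodic functions\<close>

definition smooth :: "(real \<Rightarrow> real) \<Rightarrow> bool" where
  "smooth g \<longleftrightarrow> (\<forall>k s. (deriv ^^ k) g field_differentiable (at s))"

definition periodic1 :: "(real \<Rightarrow> real) \<Rightarrow> bool" where
  "periodic1 g \<longleftrightarrow> (\<forall>s. g (s + 1) = g s)"

lemma smooth_imp_has_deriv:
  assumes "smooth g"
  shows "((deriv ^^ k) g has_field_derivative (deriv ^^ Suc k) g s) (at s)"
  using assms unfolding smooth_def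
  by (simp add: DERIV_deriv_iff_field_differentiable)

lemma higher_deriv_lincomb:
  assumes "smooth g" "smooth h"
  shows "(deriv ^^ k) (\<lambda>s. a * g s + b * h s) = (\<lambda>s. a * (deriv ^^ k) g s + b * (deriv ^^ k) h s)"
proof (induction k)
  case (Suc k)
  have "deriv (\<lambda>s. a * (deriv ^^ k) g s + b * (deriv ^^ k) h s) s
      = a * (deriv ^^ Suc k) g s + b * (deriv ^^ Suc k) h s" for s
    by (rule DERIV_imp_deriv)
       (intro DERIV_add DERIV_cmult smooth_imp_has_deriv assms)
  then show ?case
    using Suc.IH by auto
qed auto

lemma smooth_lincomb:
  assumes "smooth g" "smooth h"
  shows "smooth (\<lambda>s. a * g s + b * h s)"
  unfolding smooth_def higher_deriv_lincomb[OF assms]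
  by (intro allI field_differentiable_add field_differentiable_mult field_differentiable_const)
     (use assms in \<open>auto simp: smooth_def\<close>)

lemma higher_deriv_zero: "(deriv ^^ k) (\<lambda>_. 0 :: real) = (\<lambda>_. 0)"
  by (induction k) auto

lemma smooth_zero: "smooth (\<lambda>_. 0)"
  by (simp add: smooth_def higher_deriv_zero)

lemma periodic1_higher_deriv:
  assumes "smooth g" "periodic1 g"
  shows "periodic1 ((deriv ^^ k) g)"
proof (induction k)
  case 0
  then show ?case using assms by simp
next
  case (Suc k)
  have "(deriv ^^ Suc k) g (s + 1) = (deriv ^^ Suc k) g s" for s
  proof -
    have "((deriv ^^ k) g has_field_derivative (deriv ^^ Suc k) g (s + 1)) (at (s + 1))"
      by (rule smooth_imp_has_deriv[OF assms(1)])
    then have "((\<lambda>s. (deriv ^^ k) g (s + 1)) has_field_derivative (deriv ^^ Suc k) g (s + 1)) (at s)"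
      by (simp add: DERIV_shift)
    moreover have "(\<lambda>s. (deriv ^^ k) g (s + 1)) = (deriv ^^ k) g"
      using Suc.IH by (simp add: periodic1_def)
    ultimately show ?thesis
      using DERIV_unique smooth_imp_has_deriv[OF assms(1)] by metis
  qed
  then show ?case by (simp add: periodic1_def)
qed

lemma periodic1_add_nat:
  assumes "periodic1 g"
  shows "g (s + real n) = g s"
proof (induction n)
  case (Suc n)
  have "g (s + real (Suc n)) = g ((s + real n) + 1)"
    by (simp add: algebra_simps)
  also have "\<dots> = g s"
    using Suc.IH assms unfolding periodic1_def by metis
  finally show ?case .
qed simp

lemma periodic1_frac:
  assumes "periodic1 g"
  shows "g (frac s) = g s"
proof (cases "\<lfloor>s\<rfloor> \<ge> 0")
  case True
  then have "s = frac s + real (nat \<lfloor>s\<rfloor>)"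
    by (simp add: frac_def)
  then show ?thesis
    using periodic1_add_nat[OF assms] by metis
next
  case False
  then have "frac s = s + real (nat (- \<lfloor>s\<rfloor>))"
    by (simp add: frac_def)
  then show ?thesis
    using periodic1_add_nat[OF assms] by metis
qed

lemma bounded_higher_deriv:
  assumes "smooth g" "periodic1 g"
  obtains M where "\<And>s. \<bar>(deriv ^^ k) g s\<bar> \<le> M"
proof -
  have "continuous_on {0..1} ((deriv ^^ k) g)"
    using smooth_imp_has_deriv[OF assms(1)]
    by (meson DERIV_isCont continuous_at_imp_continuous_on)
  then have "bounded ((deriv ^^ k) g ` {0..1})"
    by (intro compact_imp_bounded compact_continuous_image) auto
  then obtain M where M: "\<And>s. s \<in> {0..1} \<Longrightarrow> \<bar>(deriv ^^ k) g s\<bar> \<le> M"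
    unfolding bounded_iff by fastforce
  have "\<bar>(deriv ^^ k) g s\<bar> \<le> M" for s
    using M[of "frac s"] periodic1_frac[OF periodic1_higher_deriv[OF assms]]
    by (simp add: frac_lt_1 less_imp_le)
  then show ?thesis by (rule that)
qed

section \<open>The space of smooth 1-periodic functions\<close>

typedef smooth_per = "{x. smooth x \<and> periodic1 x}"
  morphisms ev Smooth_per
  by (rule exI[of _ "\<lambda>_. 0"]) (simp add: smooth_zero periodic1_def)

setup_lifting type_definition_smooth_per

lemma smooth_ev: "smooth (ev x)" and periodic1_ev: "periodic1 (ev x)"
  using ev[of x] by auto

instantiation smooth_per :: real_vector
begin

lift_definition zero_smooth_per :: smooth_per is "\<lambda>_. 0"
  by (simp add: smooth_zero periodic1_def)

lift_definition plus_smooth_per :: "smooth_per \<Rightarrow> smooth_per \<Rightarrow> smooth_per"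
  is "\<lambda>x y s. x s + y s"
  using smooth_lincomb[of _ _ 1 1] by (simp add: periodic1_def)

lift_definition minus_smooth_per :: "smooth_per \<Rightarrow> smooth_per \<Rightarrow> smooth_per"
  is "\<lambda>x y s. x s - y s"
  using smooth_lincomb[of _ _ 1 "-1"] by (simp add: periodic1_def)

lift_definition uminus_smooth_per :: "smooth_per \<Rightarrow> smooth_per"
  is "\<lambda>x s. - x s"
  using smooth_lincomb[of _ "\<lambda>_. 0" "-1" 0] by (simp add: periodic1_def smooth_zero)

lift_definition scaleR_smooth_per :: "real \<Rightarrow> smooth_per \<Rightarrow> smooth_per"
  is "\<lambda>c x s. c * x s"
  using smooth_lincomb[of _ "\<lambda>_. 0" _ 0] by (simp add: periodic1_def smooth_zero)

instance
  by standard (transfer; simp add: fun_eq_iff algebra_simps)+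

end

text \<open>The norms \<open>p\<^sub>i\<close>. The set is nonempty and bounded above, so \<open>Sup\<close> is the true supremum.\<close>

definition pnorm :: "nat \<Rightarrow> smooth_per \<Rightarrow> real" where
  "pnorm i u = Sup {\<bar>(deriv ^^ l) (ev u) s\<bar> | s l. l \<le> i}"

lemma pnorm_bdd_above: "bdd_above {\<bar>(deriv ^^ l) (ev u) s\<bar> | s l. l \<le> i}"
proof -
  have "\<exists>M. \<forall>s. \<bar>(deriv ^^ l) (ev u) s\<bar> \<le> M" for l
    using bounded_higher_deriv[OF smooth_ev periodic1_ev] by metis
  then obtain M where M: "\<And>l s. \<bar>(deriv ^^ l) (ev u) s\<bar> \<le> M l"
    by metis
  have "\<bar>(deriv ^^ l) (ev u) s\<bar> \<le> Max (M ` {..i})" if "l \<le> i" for l s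
    using M[of l s] that by (intro order_trans[OF M] Max_ge) auto
  then show ?thesis
    by (intro bdd_aboveI) auto
qed

lemma pnorm_upper:
  assumes "l \<le> i"
  shows "\<bar>(deriv ^^ l) (ev u) s\<bar> \<le> pnorm i u"
  unfolding pnorm_def by (rule cSup_upper[OF _ pnorm_bdd_above]) (use assms in blast)

lemma pnorm_mono:
  assumes "i \<le> j"
  shows "pnorm i u \<le> pnorm j u"
  unfolding pnorm_def
  by (rule cSup_subset_mono[OF _ pnorm_bdd_above]) (use assms in \<open>force+\<close>)

instantiation smooth_per :: t2_space
begin

definition open_smooth_per :: "smooth_per set \<Rightarrow> bool" where
  "open S \<longleftrightarrow> (\<forall>x\<in>S. \<exists>i. \<exists>e>0. \<forall>y. pnorm i (y - x) < e \<longrightarrow> y \<in> S)"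

instance
proof
  show "open (UNIV :: smooth_per set)"
    unfolding open_smooth_per_def by (auto intro: exI[of _ 1])
next
  fix S T :: "smooth_per set"
  assume S: "open S" and T: "open T"
  show "open (S \<inter> T)"
    unfolding open_smooth_per_def
  proof
    fix x assume x: "x \<in> S \<inter> T"
    obtain i d where d: "d > 0" "\<And>y. pnorm i (y - x) < d \<Longrightarrow> y \<in> S"
      using S x unfolding open_smooth_per_def by (metis IntD1)
    obtain j e where e: "e > 0" "\<And>y. pnorm j (y - x) < e \<Longrightarrow> y \<in> T"
      using T x unfolding open_smooth_per_def by (metis IntD2)
    have "y \<in> S \<inter> T" if "pnorm (max i j) (y - x) < min d e" for y
      using that pnorm_mono[of i "max i j" "y - x"] pnorm_mono[of j "max i j" "y - x"] d(2) e(2)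
      by auto
    then show "\<exists>i. \<exists>e>0. \<forall>y. pnorm i (y - x) < e \<longrightarrow> y \<in> S \<inter> T"
      using d(1) e(1) by (metis min_less_iff_conj)
  qed
next
  fix K :: "smooth_per set set"
  assume "\<forall>S\<in>K. open S"
  then show "open (\<Union>K)"
    unfolding open_smooth_per_def by (meson Union_iff)
next
  fix x y :: smooth_per
  assume "x \<noteq> y"
  then obtain s where s: "ev x s \<noteq> ev y s"
    by (metis ev_inject ext)
  have "open {z. \<bar>ev z s - c\<bar> < e}" for c e
    unfolding open_smooth_per_def
  proof
    fix z assume z: "z \<in> {z. \<bar>ev z s - c\<bar> < e}"
    have "\<bar>ev w s - c\<bar> < e" if "pnorm 0 (w - z) < e - \<bar>ev z s - c\<bar>" for w
      using that pnorm_upper[of 0 0 "w - z" s] by (simp add: minus_smooth_per.rep_eq)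
    then show "\<exists>i. \<exists>d>0. \<forall>w. pnorm i (w - z) < d \<longrightarrow> w \<in> {z. \<bar>ev z s - c\<bar> < e}"
      using z by (intro exI[of _ 0] exI[of _ "e - \<bar>ev z s - c\<bar>"]) auto
  qed
  then have "open {z. \<bar>ev z s - ev x s\<bar> < \<bar>ev x s - ev y s\<bar> / 2}"
    "open {z. \<bar>ev z s - ev y s\<bar> < \<bar>ev x s - ev y s\<bar> / 2}"
    by blast+
  moreover have "x \<in> {z. \<bar>ev z s - ev x s\<bar> < \<bar>ev x s - ev y s\<bar> / 2}"
    "y \<in> {z. \<bar>ev z s - ev y s\<bar> < \<bar>ev x s - ev y s\<bar> / 2}"
    using s by auto
  moreover have "{z. \<bar>ev z s - ev x s\<bar> < \<bar>ev x s - ev y s\<bar> / 2}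
      \<inter> {z. \<bar>ev z s - ev y s\<bar> < \<bar>ev x s - ev y s\<bar> / 2} = {}"
    by (auto simp: abs_if split: if_splits)
  ultimately show "\<exists>U V. open U \<and> open V \<and> x \<in> U \<and> y \<in> V \<and> U \<inter> V = {}"
    by blast
qed

end

section \<open>P-norms, directional derivatives and almost M-tame maps\<close>

text \<open>These notions are stated for real vector spaces with a Hausdorff topology; they are meant
  for Frechet spaces, but completeness and local convexity do not enter the definitions.\<close>

definition P_norm :: "('a::{real_vector,t2_space} \<Rightarrow> real) \<Rightarrow> bool" where
  "P_norm \<rho> \<longleftrightarrow> Metric_space UNIV (\<lambda>x y. \<rho> (x - y))
     \<and> Metric_space.mtopology UNIV (\<lambda>x y. \<rho> (x - y)) = euclidean"

text \<open>A partial map is a total function together with its domain \<open>D\<close>; values outside \<open>D\<close> are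
  irrelevant. The limit below presupposes that the difference quotient is defined for all small
  \<open>t \<noteq> 0\<close>.\<close>

definition has_dir_deriv ::
  "'a::{real_vector,t2_space} set \<Rightarrow> ('a \<Rightarrow> 'b::{real_vector,t2_space}) \<Rightarrow> 'a \<Rightarrow> 'a \<Rightarrow> 'b \<Rightarrow> bool"
  where "has_dir_deriv D f x u d \<longleftrightarrow> x \<in> D
     \<and> (\<forall>\<^sub>F t in at (0::real). x + t *\<^sub>R u \<in> D)
     \<and> ((\<lambda>t. inverse t *\<^sub>R (f (x + t *\<^sub>R u) - f x)) \<longlongrightarrow> d) (at 0)"

definition dir_deriv ::
  "'a::{real_vector,t2_space} set \<Rightarrow> ('a \<Rightarrow> 'b::{real_vector,t2_space}) \<Rightarrow> 'a \<Rightarrow> 'a \<Rightarrow> 'b"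
  where "dir_deriv D f x u = (THE d. has_dir_deriv D f x u d)"

definition directionally_differentiable ::
  "'a::{real_vector,t2_space} set \<Rightarrow> ('a \<Rightarrow> 'b::{real_vector,t2_space}) \<Rightarrow> bool"
  where "directionally_differentiable D f \<longleftrightarrow> (\<forall>x\<in>D. \<forall>u. \<exists>d. has_dir_deriv D f x u d)"

lemma dir_deriv_eq:
  assumes "has_dir_deriv D f x u d"
  shows "dir_deriv D f x u = d"
  unfolding dir_deriv_def
proof (rule the_equality)
  show "has_dir_deriv D f x u d" by (rule assms)
next
  fix d' assume "has_dir_deriv D f x u d'"
  then show "d' = d"
    using assms unfolding has_dir_deriv_def
    by (meson tendsto_unique trivial_limit_at)
qed

definition almost_M_tame_at ::
  "'a::{real_vector,t2_space} set \<Rightarrow> ('a \<Rightarrow> 'b::{real_vector,t2_space}) \<Rightarrow> 'a \<Rightarrow> bool"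
  where "almost_M_tame_at D f x \<longleftrightarrow> directionally_differentiable D f
     \<and> (\<exists>\<rho>1 \<rho>2. P_norm \<rho>1 \<and> P_norm \<rho>2
          \<and> (\<forall>z u. \<rho>1 z \<le> 1 \<longrightarrow> x + z \<in> D
                 \<and> \<rho>2 (dir_deriv D f (x + z) u - dir_deriv D f x u) \<le> \<rho>1 u))"

section \<open>The domain of the map\<close>

definition Udom :: "int \<Rightarrow> smooth_per set" where
  "Udom n = {x. 0 < (INF s. \<bar>of_int n + deriv (ev x) s\<bar>)}"

end

theory Submission
  imports Defs
begin

text \<open>Write \<open>h\<^sub>y(s) = \<phi>(n s + y(s))\<close>. In the direction of a constant \<open>c\<close> the derivative of \<open>f\<close> at
  \<open>y\<close> is \<open>c h\<^sub>y'\<close>, so for a small \<open>c\<close> almost M-tameness at \<open>x\<close> bounds all derivatives of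
  \<open>h\<^bsub>x+z\<^esub>\<close> of any prescribed order uniformly for \<open>z\<close> in a neighbourhood of \<open>0\<close>. This
  neighbourhood contains a ball of some norm \<open>p\<^sub>m\<close> and does not depend on the order. The derivative
  of order \<open>m + 1\<close> is \<open>\<phi>'(n s + x + z) z\<^bsup>(m+1)\<^esup>\<close> up to terms that are bounded on
  the ball; if \<open>\<phi>'\<close> does not vanish identically, a sine of high frequency makes it arbitrarily
  large.\<close>

section \<open>Higher derivatives of products and compositions\<close>

text \<open>Leibniz rule. Differentiability is assumed only for orders below \<open>k\<close>, so
  that the rule can be applied inside the induction that first proves compositions to be
  smooth.\<close>

lemma higher_deriv_mult:
  fixes g h :: "real \<Rightarrow> real"
  assumes g: "\<And>j s. j < k \<Longrightarrow> (deriv ^^ j) g field_differentiable (at s)"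
    and h: "\<And>j s. j < k \<Longrightarrow> (deriv ^^ j) h field_differentiable (at s)"
  shows "(deriv ^^ k) (\<lambda>s. g s * h s)
    = (\<lambda>s. \<Sum>j\<le>k. real (k choose j) * (deriv ^^ j) g s * (deriv ^^ (k - j)) h s)"
  using assms
proof (induction k)
  case (Suc k)
  have D: "((deriv ^^ j) g has_field_derivative (deriv ^^ Suc j) g s) (at s)"
    "((deriv ^^ j) h has_field_derivative (deriv ^^ Suc j) h s) (at s)" if "j \<le> k" for j s
    using Suc.prems that by (simp_all add: DERIV_deriv_iff_field_differentiable)
  have sumeq: "(\<Sum>j\<le>k. real (k choose j) * ((deriv ^^ Suc j) g s * (deriv ^^ (k - j)) h s
        + (deriv ^^ j) g s * (deriv ^^ Suc (k - j)) h s))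
      = (\<Sum>j\<le>Suc k. real (Suc k choose j) * (deriv ^^ j) g s * (deriv ^^ (Suc k - j)) h s)" for s
  proof -
    \<comment> \<open>The added term \<open>j = Suc k\<close> vanishes since
      \<open>k choose Suc k\<close> is 0. After the term \<open>j = 0\<close> is split off, Pascal's
      rule merges the two sums.\<close>
    have "(\<Sum>j\<le>k. real (k choose j) * (deriv ^^ j) g s * (deriv ^^ Suc (k - j)) h s)
        = (\<Sum>j\<le>Suc k. real (k choose j) * (deriv ^^ j) g s * (deriv ^^ (Suc k - j)) h s)"
      by (simp add: Suc_diff_le del: funpow.simps)
    also have "\<dots> = g s * (deriv ^^ Suc k) h s
        + (\<Sum>j\<le>k. real (k choose Suc j) * (deriv ^^ Suc j) g s * (deriv ^^ (k - j)) h s)"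
      by (subst sum.atMost_Suc_shift) (simp del: funpow.simps add: funpow_0)
    finally show ?thesis
      by (subst sum.atMost_Suc_shift)
        (simp add: sum.distrib algebra_simps funpow_0 del: funpow.simps)
  qed
  have "((\<lambda>s. \<Sum>j\<le>k. real (k choose j) * (deriv ^^ j) g s * (deriv ^^ (k - j)) h s)
      has_field_derivative (\<Sum>j\<le>k. real (k choose j) * ((deriv ^^ Suc j) g s * (deriv ^^ (k - j)) h s
        + (deriv ^^ j) g s * (deriv ^^ Suc (k - j)) h s))) (at s)" for s
    by (rule DERIV_sum)
      (auto intro!: derivative_eq_intros D simp: algebra_simps simp del: funpow.simps)
  then have "deriv (\<lambda>s. \<Sum>j\<le>k. real (k choose j) * (deriv ^^ j) g s * (deriv ^^ (k - j)) h s)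
    = (\<lambda>s. \<Sum>j\<le>Suc k. real (Suc k choose j) * (deriv ^^ j) g s * (deriv ^^ (Suc k - j)) h s)"
    unfolding sumeq by (intro ext DERIV_imp_deriv)
  then show ?case
    using Suc.IH Suc.prems by simp
qed simp

lemma smooth_higher_deriv: "smooth g \<Longrightarrow> smooth ((deriv ^^ k) g)"
  unfolding smooth_def by (metis comp_apply funpow_add)

lemma smooth_deriv: "smooth g \<Longrightarrow> smooth (deriv g)"
  using smooth_higher_deriv[of g 1] by simp

lemma higher_deriv_deriv: "(deriv ^^ k) (deriv g) = (deriv ^^ Suc k) g"
  by (simp add: funpow_swap1)

lemma smooth_DERIV: "smooth g \<Longrightarrow> (g has_field_derivative deriv g s) (at s)"
  using smooth_imp_has_deriv[of g 0 s] by simp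

lemma deriv_compose:
  assumes "smooth g" "smooth h"
  shows "deriv (\<lambda>s. h (g s)) = (\<lambda>s. deriv h (g s) * deriv g s)"
  by (intro ext DERIV_imp_deriv) (rule DERIV_chain2[OF smooth_DERIV smooth_DERIV, OF assms(2,1)])

text \<open>One differentiation turns \<open>h (g s)\<close> into
  \<open>deriv h (g s) * deriv g s\<close>. By Leibniz, what remains involves only lower orders of
  \<open>deriv h\<close> composed with \<open>g\<close>, hence the strong induction with
  \<open>h\<close> arbitrary.\<close>

lemma higher_deriv_compose_differentiable:
  assumes "smooth g" "smooth h"
  shows "(deriv ^^ k) (\<lambda>s. h (g s)) field_differentiable (at s)"
  using assms(2)
proof (induction k arbitrary: h s rule: less_induct)
  case (less k)
  show ?case
  proof (cases k)
    case 0
    then show ?thesis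
      using DERIV_chain2[OF smooth_DERIV[OF less.prems] smooth_DERIV[OF assms(1)]]
      by (auto simp: field_differentiable_def)
  next
    case (Suc m)
    have h': "(deriv ^^ j) (\<lambda>s. deriv h (g s)) field_differentiable (at s)" if "j \<le> m" for j s
      using less.IH[of j "deriv h"] smooth_deriv[OF less.prems] that Suc by simp
    have g': "(deriv ^^ j) (deriv g) field_differentiable (at s)" for j s
      using smooth_deriv[OF assms(1)] by (simp add: smooth_def)
    have "(deriv ^^ k) (\<lambda>s. h (g s)) = (deriv ^^ m) (\<lambda>s. deriv h (g s) * deriv g s)"
      unfolding Suc deriv_compose[OF assms(1) less.prems, symmetric] higher_deriv_deriv ..
    also have "\<dots> = (\<lambda>s. \<Sum>j\<le>m. real (m choose j) * (deriv ^^ j) (\<lambda>s. deriv h (g s)) s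
        * (deriv ^^ (m - j)) (deriv g) s)"
      by (rule higher_deriv_mult) (auto intro: h' g')
    finally show ?thesis
      by (auto intro!: field_differentiable_sum field_differentiable_mult h' g')
  qed
qed

lemma smooth_compose:
  assumes "smooth g" "smooth h"
  shows "smooth (\<lambda>s. h (g s))"
  using higher_deriv_compose_differentiable[OF assms] by (simp add: smooth_def)

text \<open>Chain rule once, then Leibniz: a recursive substitute for the formula of Faa di Bruno.
  Only the term \<open>j = 0\<close> contains the derivative of \<open>g\<close> of order
  \<open>m + 1\<close>.\<close>

lemma higher_deriv_compose:
  assumes "smooth g" "smooth h"
  shows "(deriv ^^ Suc m) (\<lambda>s. h (g s)) s
    = (\<Sum>j\<le>m. real (m choose j) * (deriv ^^ j) (\<lambda>s. deriv h (g s)) s * (deriv ^^ Suc (m - j)) g s)"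
proof -
  have "(deriv ^^ Suc m) (\<lambda>s. h (g s)) = (deriv ^^ m) (\<lambda>s. deriv h (g s) * deriv g s)"
    unfolding deriv_compose[OF assms, symmetric] higher_deriv_deriv ..
  also have "\<dots> = (\<lambda>s. \<Sum>j\<le>m. real (m choose j) * (deriv ^^ j) (\<lambda>s. deriv h (g s)) s
        * (deriv ^^ (m - j)) (deriv g) s)"
    using smooth_deriv[OF assms(1)] smooth_compose[OF assms(1) smooth_deriv[OF assms(2)]]
    by (intro higher_deriv_mult) (auto simp: smooth_def)
  finally show ?thesis
    by (simp only: higher_deriv_deriv)
qed

text \<open>\<open>B\<close> depends on \<open>h\<close>, \<open>m\<close> and \<open>M\<close>, but
  not on \<open>g\<close> or \<open>s\<close>. The values of \<open>g\<close> may be unbounded, as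
  those of \<open>a * s + ev y s\<close> are: periodicity bounds \<open>h\<close> on the whole
  line.\<close>

lemma higher_deriv_compose_bounded:
  assumes "smooth h" "periodic1 h"
  shows "\<exists>B. \<forall>g s. smooth g \<longrightarrow> (\<forall>l\<in>{1..m}. \<bar>(deriv ^^ l) g s\<bar> \<le> M)
    \<longrightarrow> \<bar>(deriv ^^ m) (\<lambda>s. h (g s)) s\<bar> \<le> B"
  using assms
proof (induction m arbitrary: h rule: less_induct)
  case (less m)
  show ?case
  proof (cases m)
    case 0
    obtain B where "\<And>s. \<bar>h s\<bar> \<le> B"
      using bounded_higher_deriv[OF less.prems, of 0] by auto
    then show ?thesis
      using 0 by auto
  next
    case (Suc k)
    have "\<forall>j\<in>{..k}. \<exists>B. \<forall>g s. smooth g \<longrightarrow> (\<forall>l\<in>{1..j}. \<bar>(deriv ^^ l) g s\<bar> \<le> M)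
        \<longrightarrow> \<bar>(deriv ^^ j) (\<lambda>s. deriv h (g s)) s\<bar> \<le> B"
      using less.IH[of _ "deriv h"] smooth_deriv[OF less.prems(1)]
        periodic1_higher_deriv[OF less.prems, of 1] Suc by simp
    then obtain B where B: "\<And>j g s. j \<le> k \<Longrightarrow> smooth g \<Longrightarrow> (\<forall>l\<in>{1..j}. \<bar>(deriv ^^ l) g s\<bar> \<le> M)
        \<Longrightarrow> \<bar>(deriv ^^ j) (\<lambda>s. deriv h (g s)) s\<bar> \<le> B j"
      by (metis atMost_iff)
    have "\<bar>(deriv ^^ m) (\<lambda>s. h (g s)) s\<bar> \<le> (\<Sum>j\<le>k. real (k choose j) * B j * M)"
      if g: "smooth g" and bd: "\<forall>l\<in>{1..m}. \<bar>(deriv ^^ l) g s\<bar> \<le> M" for g s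
      unfolding Suc higher_deriv_compose[OF g less.prems(1)]
    proof (rule order_trans[OF sum_abs sum_mono])
      fix j assume j: "j \<in> {..k}"
      have "\<bar>(deriv ^^ j) (\<lambda>s. deriv h (g s)) s\<bar> \<le> B j"
        using B[of j g s] j g bd Suc by simp
      moreover have "\<bar>(deriv ^^ Suc (k - j)) g s\<bar> \<le> M"
        using bd Suc by (metis Suc_le_mono atLeastAtMost_iff diff_le_self le_add1 plus_1_eq_Suc)
      ultimately show "\<bar>real (k choose j) * (deriv ^^ j) (\<lambda>s. deriv h (g s)) s
          * (deriv ^^ Suc (k - j)) g s\<bar> \<le> real (k choose j) * B j * M"
        unfolding abs_mult by (intro mult_mono mult_nonneg_nonneg) auto
    qed
    then show ?thesis
      by blast
  qed
qed

text \<open>Apart from the term \<open>j = 0\<close>, the sum in \<open>higher_deriv_compose\<close>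
  involves derivatives of \<open>g\<close> of orders 1 to \<open>m\<close> only, and these are
  controlled by \<open>M\<close>.\<close>

lemma higher_deriv_compose_leading_term:
  assumes "smooth h" "periodic1 h"
  obtains B where "\<And>g s. smooth g \<Longrightarrow> (\<And>l. 1 \<le> l \<Longrightarrow> l \<le> m \<Longrightarrow> \<bar>(deriv ^^ l) g s\<bar> \<le> M)
    \<Longrightarrow> \<bar>(deriv ^^ Suc m) (\<lambda>s. h (g s)) s - deriv h (g s) * (deriv ^^ Suc m) g s\<bar> \<le> B"
proof -
  obtain B where B: "\<And>j g s. smooth g \<Longrightarrow> (\<forall>l\<in>{1..j}. \<bar>(deriv ^^ l) g s\<bar> \<le> M)
      \<Longrightarrow> \<bar>(deriv ^^ j) (\<lambda>s. deriv h (g s)) s\<bar> \<le> B j"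
    using higher_deriv_compose_bounded[OF smooth_deriv[OF assms(1)], of _ M]
      periodic1_higher_deriv[OF assms, of 1] by (simp del: Ball_def) metis
  have "\<bar>(deriv ^^ Suc m) (\<lambda>s. h (g s)) s - deriv h (g s) * (deriv ^^ Suc m) g s\<bar>
      \<le> (\<Sum>j=1..m. real (m choose j) * B j * M)"
    if g: "smooth g" and bd: "\<And>l. 1 \<le> l \<Longrightarrow> l \<le> m \<Longrightarrow> \<bar>(deriv ^^ l) g s\<bar> \<le> M" for g s
  proof -
    have "{..m} = insert 0 {1..m}"
      by auto
    then have "(deriv ^^ Suc m) (\<lambda>s. h (g s)) s - deriv h (g s) * (deriv ^^ Suc m) g s
      = (\<Sum>j=1..m. real (m choose j) * (deriv ^^ j) (\<lambda>s. deriv h (g s)) s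
          * (deriv ^^ Suc (m - j)) g s)"
      unfolding higher_deriv_compose[OF g assms(1)] by (simp del: funpow.simps add: funpow_0)
    also have "\<bar>\<dots>\<bar> \<le> (\<Sum>j=1..m. real (m choose j) * B j * M)"
    proof (rule order_trans[OF sum_abs sum_mono])
      fix j assume j: "j \<in> {1..m}"
      have "\<bar>(deriv ^^ j) (\<lambda>s. deriv h (g s)) s\<bar> \<le> B j"
        using B[of g j s] j g bd by simp
      moreover have "\<bar>(deriv ^^ Suc (m - j)) g s\<bar> \<le> M"
        using j by (intro bd) auto
      ultimately show "\<bar>real (m choose j) * (deriv ^^ j) (\<lambda>s. deriv h (g s)) s
          * (deriv ^^ Suc (m - j)) g s\<bar> \<le> real (m choose j) * B j * M"
        unfolding abs_mult by (intro mult_mono mult_nonneg_nonneg) auto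
    qed
    finally show ?thesis .
  qed
  then show ?thesis
    by (rule that)
qed

section \<open>P-norms on the space of smooth periodic functions\<close>

lemma pnorm_least:
  assumes "\<And>l s. l \<le> i \<Longrightarrow> \<bar>(deriv ^^ l) (ev u) s\<bar> \<le> C"
  shows "pnorm i u \<le> C"
  unfolding pnorm_def by (rule cSup_least) (use assms in auto)

lemma higher_deriv_ev_diff:
  "(deriv ^^ l) (ev (u - v)) s = (deriv ^^ l) (ev u) s - (deriv ^^ l) (ev v) s"
  using fun_cong[OF higher_deriv_lincomb[OF smooth_ev smooth_ev, of l 1 u "-1" v], of s]
  by (simp add: minus_smooth_per.rep_eq[abs_def])

lemma higher_deriv_ev_add:
  "(deriv ^^ l) (ev (u + v)) s = (deriv ^^ l) (ev u) s + (deriv ^^ l) (ev v) s"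
  using fun_cong[OF higher_deriv_lincomb[OF smooth_ev smooth_ev, of l 1 u 1 v], of s]
  by (simp add: plus_smooth_per.rep_eq[abs_def])

lemma pnorm_triangle: "pnorm i (u + v) \<le> pnorm i u + pnorm i v"
proof (rule pnorm_least)
  fix l s assume l: "l \<le> i"
  show "\<bar>(deriv ^^ l) (ev (u + v)) s\<bar> \<le> pnorm i u + pnorm i v"
    using pnorm_upper[OF l, of u s] pnorm_upper[OF l, of v s]
    unfolding higher_deriv_ev_add by linarith
qed

lemma pnorm_zero: "pnorm i 0 = 0"
proof (rule antisym)
  show "pnorm i 0 \<le> 0"
    by (rule pnorm_least) (simp add: zero_smooth_per.rep_eq[abs_def] higher_deriv_zero)
  show "0 \<le> pnorm i 0"
    using pnorm_upper[of 0 i 0 0] by simp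
qed

lemma open_pnorm_less: "open {u. pnorm i u < e}"
  unfolding open_smooth_per_def
proof
  fix u assume u: "u \<in> {u. pnorm i u < e}"
  have "pnorm i v < e" if "pnorm i (v - u) < e - pnorm i u" for v
    using that pnorm_triangle[of i "v - u" u] by simp
  then show "\<exists>j. \<exists>d>0. \<forall>v. pnorm j (v - u) < d \<longrightarrow> v \<in> {u. pnorm i u < e}"
    using u by (intro exI[of _ i] exI[of _ "e - pnorm i u"]) auto
qed

text \<open>Balls of the metric are open for the norms \<open>p_i\<close>, so a ball around 0
  contains a ball of a single norm, whose order \<open>i\<close> depends on \<open>\<rho>\<close>
  and \<open>r\<close>.\<close>

lemma P_norm_small_if_pnorm_small:
  fixes \<rho> :: "smooth_per \<Rightarrow> real"
  assumes "P_norm \<rho>" "0 < r"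
  obtains i e where "0 < e" "\<And>z. pnorm i z < e \<Longrightarrow> \<rho> z < r"
proof -
  interpret Metric_space UNIV "\<lambda>x y. \<rho> (x - y)"
    using assms(1) by (simp add: P_norm_def)
  have "open (mball 0 r)"
    using assms(1) openin_mball[of 0 r] by (simp add: P_norm_def)
  moreover have "0 \<in> mball 0 r"
    using assms(2) by (subst centre_in_mball_iff) auto
  ultimately obtain i e where "0 < e" "\<And>z. pnorm i (z - 0) < e \<Longrightarrow> z \<in> mball 0 r"
    unfolding open_smooth_per_def by metis
  then show ?thesis
    using that[of e i] commute[of 0] by (auto simp: subset_iff)
qed

text \<open>The opposite comparison of topologies; here the order \<open>i\<close> can be
  prescribed.\<close>

lemma pnorm_small_if_P_norm_small:
  fixes \<rho> :: "smooth_per \<Rightarrow> real"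
  assumes "P_norm \<rho>" "0 < r"
  obtains d where "0 < d" "\<And>z. \<rho> z < d \<Longrightarrow> pnorm i z < r"
proof -
  interpret Metric_space UNIV "\<lambda>x y. \<rho> (x - y)"
    using assms(1) by (simp add: P_norm_def)
  have "openin mtopology {u. pnorm i u < r}"
    using assms(1) open_pnorm_less by (simp add: P_norm_def)
  moreover have "0 \<in> {u. pnorm i u < r}"
    using assms(2) by (simp add: pnorm_zero)
  ultimately obtain d where "0 < d" "mball 0 d \<subseteq> {u. pnorm i u < r}"
    unfolding openin_mtopology by blast
  then show ?thesis
    using that[of d] commute[of 0] by (auto simp: subset_iff)
qed

text \<open>Evaluation at a point is continuous because it is dominated by \<open>p_0\<close>.
  Limits defining directional derivatives can therefore be computed pointwise.\<close>

lemma tendsto_ev: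
  assumes "(F \<longlongrightarrow> d) A"
  shows "((\<lambda>t. ev (F t) s) \<longlongrightarrow> ev d s) A"
  unfolding tendsto_iff
proof (intro allI impI)
  fix e :: real assume "0 < e"
  have "open {w. pnorm 0 (w - d) < e}"
    unfolding open_smooth_per_def
  proof
    fix w assume w: "w \<in> {w. pnorm 0 (w - d) < e}"
    have "pnorm 0 (v - d) < e" if "pnorm 0 (v - w) < e - pnorm 0 (w - d)" for v
      using that pnorm_triangle[of 0 "v - w" "w - d"] by simp
    then show "\<exists>j. \<exists>r>0. \<forall>v. pnorm j (v - w) < r \<longrightarrow> v \<in> {w. pnorm 0 (w - d) < e}"
      using w by (intro exI[of _ 0] exI[of _ "e - pnorm 0 (w - d)"]) auto
  qed
  then have "\<forall>\<^sub>F t in A. F t \<in> {w. pnorm 0 (w - d) < e}"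
    using \<open>0 < e\<close> by (intro topological_tendstoD[OF assms]) (auto simp: pnorm_zero)
  then show "\<forall>\<^sub>F t in A. dist (ev (F t) s) (ev d s) < e"
  proof eventually_elim
    case (elim t)
    then show ?case
      using pnorm_upper[of 0 0 "F t - d" s] by (simp add: dist_real_def minus_smooth_per.rep_eq)
  qed
qed

lemma higher_deriv_const_fun:
  "(deriv ^^ k) (\<lambda>_. c :: real) = (\<lambda>_. if k = 0 then c else 0)"
  by (induction k) auto

lift_definition const_per :: "real \<Rightarrow> smooth_per" is "\<lambda>c _. c"
  by (simp add: periodic1_def smooth_def higher_deriv_const_fun)

text \<open>The derivatives of positive order vanish, so small constants are small in every norm
  \<open>p_i\<close> at once.\<close>

lemma pnorm_const_per: "pnorm i (const_per c) \<le> \<bar>c\<bar>"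
  by (rule pnorm_least) (simp add: const_per.rep_eq higher_deriv_const_fun)

section \<open>High-frequency perturbations\<close>

text \<open>Each differentiation multiplies the amplitude by \<open>w\<close> and advances the phase
  by \<open>pi / 2\<close>.\<close>

lemma higher_deriv_wave:
  "(deriv ^^ k) (\<lambda>s. A * sin (w * s + c)) = (\<lambda>s. A * w ^ k * sin (w * s + c + real k * (pi / 2)))"
proof (induction k)
  case (Suc k)
  have "deriv (\<lambda>s. A * w ^ k * sin (w * s + c + real k * (pi / 2))) s
      = A * w ^ Suc k * sin (w * s + c + real (Suc k) * (pi / 2))" for s
  proof (rule DERIV_imp_deriv)
    have "sin (w * s + c + real (Suc k) * (pi / 2)) = sin ((w * s + c + real k * (pi / 2)) + pi / 2)"
      by (simp add: algebra_simps add_divide_distrib)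
    also have "\<dots> = cos (w * s + c + real k * (pi / 2))"
      by (simp only: sin_add) simp
    finally show "((\<lambda>s. A * w ^ k * sin (w * s + c + real k * (pi / 2))) has_field_derivative
      A * w ^ Suc k * sin (w * s + c + real (Suc k) * (pi / 2))) (at s)"
      by (auto intro!: derivative_eq_intros)
  qed
  then show ?case
    using Suc.IH by auto
qed simp

text \<open>The frequency is an integral multiple of \<open>2 * pi\<close> to give period 1; the
  free phase \<open>c\<close> allows a derivative of chosen order to peak at a chosen point.\<close>

lift_definition wave :: "real \<Rightarrow> nat \<Rightarrow> real \<Rightarrow> smooth_per"
  is "\<lambda>A N c s. A * sin (2 * pi * real N * s + c)"
proof (intro conjI)
  fix A c :: real and N :: nat
  have "(\<lambda>s. A * (2 * pi * real N) ^ k * sin (2 * pi * real N * s + c + real k * (pi / 2)))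
      field_differentiable (at s)" for k s
    unfolding field_differentiable_def by (rule exI) (auto intro!: derivative_eq_intros)
  then show "smooth (\<lambda>s. A * sin (2 * pi * real N * s + c))"
    unfolding smooth_def higher_deriv_wave by blast
  have "sin (2 * pi * real N * (s + 1) + c) = sin ((2 * pi * real N * s + c) + 2 * pi * real N)" for s
    by (simp add: algebra_simps)
  moreover have "cos (2 * pi * real N) = 1" "sin (2 * pi * real N) = 0"
    using cos_2npi[of N] sin_2npi[of N] by (simp_all add: mult_ac)
  ultimately show "periodic1 (\<lambda>s. A * sin (2 * pi * real N * s + c))"
    unfolding periodic1_def
    by (simp add: sin_add[of "2 * pi * real N * s + c" "2 * pi * real N" for s])
qed

lemma higher_deriv_ev_wave: "(deriv ^^ k) (ev (wave A N c)) s
    = A * (2 * pi * real N) ^ k * sin (2 * pi * real N * s + c + real k * (pi / 2))"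
  by (simp add: wave.rep_eq higher_deriv_wave)

lemma abs_higher_deriv_ev_wave_le:
  assumes "0 \<le> A"
  shows "\<bar>(deriv ^^ k) (ev (wave A N c)) s\<bar> \<le> A * (2 * pi * real N) ^ k"
  using mult_left_mono[OF abs_sin_le_one, of "A * (2 * pi * real N) ^ k"] assms
  unfolding higher_deriv_ev_wave abs_mult by simp

lemma pnorm_wave_le:
  assumes "0 \<le> A" "1 \<le> 2 * pi * real N"
  shows "pnorm i (wave A N c) \<le> A * (2 * pi * real N) ^ i"
proof (rule pnorm_least)
  fix l s assume "l \<le> i"
  then have "A * (2 * pi * real N) ^ l \<le> A * (2 * pi * real N) ^ i"
    using assms by (intro mult_left_mono power_increasing)
  then show "\<bar>(deriv ^^ l) (ev (wave A N c)) s\<bar> \<le> A * (2 * pi * real N) ^ i"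
    using abs_higher_deriv_ev_wave_le[OF assms(1)] order_trans by blast
qed

section \<open>Functions of the form \<open>a * s + ev y s\<close>\<close>

lemma higher_deriv_linear:
  "(deriv ^^ l) (\<lambda>s. a * s) = (\<lambda>s. if l = 0 then a * s else if l = 1 then a else (0 :: real))"
proof (induction l)
  case (Suc l)
  have "deriv (\<lambda>s. a * s) s = a" for s
    by (rule DERIV_imp_deriv) (auto intro!: derivative_eq_intros)
  then show ?case
    using Suc.IH by auto
qed simp

lemma smooth_linear: "smooth (\<lambda>s. a * s)"
  unfolding smooth_def
proof (intro allI)
  fix k s
  show "(deriv ^^ k) (\<lambda>s. a * s) field_differentiable (at s)"
    unfolding higher_deriv_linear
    by (cases "k = 0"; cases "k = 1")
      (simp_all add: field_differentiable_mult[OF field_differentiable_const field_differentiable_ident])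
qed

lemma smooth_linear_plus_ev: "smooth (\<lambda>s. a * s + ev y s)"
  using smooth_lincomb[OF smooth_linear smooth_ev, of 1 a 1 y] by simp

text \<open>The difference is \<open>a\<close> for \<open>l = 1\<close> and 0 beyond; the inequality
  treats both cases alike.\<close>

lemma higher_deriv_linear_plus_ev:
  assumes "1 \<le> l"
  shows "\<bar>(deriv ^^ l) (\<lambda>s. a * s + ev y s) s - (deriv ^^ l) (ev y) s\<bar> \<le> \<bar>a\<bar>"
  using fun_cong[OF higher_deriv_lincomb[OF smooth_linear smooth_ev, of l 1 a 1 y], of s] assms
  by (simp add: higher_deriv_linear)

text \<open>Intermediate value theorem: the linear part attains \<open>t - pnorm 0 y\<close> and
  \<open>t + pnorm 0 y\<close>, and the periodic part deviates from 0 by at most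
  \<open>pnorm 0 y\<close>.\<close>

lemma linear_plus_ev_surj:
  assumes "a \<noteq> 0"
  obtains s where "a * s + ev y s = t"
proof -
  let ?g = "\<lambda>s. a * s + ev y s"
  have "continuous_on UNIV ?g"
    using smooth_DERIV[OF smooth_linear_plus_ev]
    by (meson DERIV_isCont continuous_at_imp_continuous_on)
  then have "connected (range ?g)"
    by (intro connected_continuous_image) auto
  moreover have "?g ((t - pnorm 0 y) / a) \<le> t" "t \<le> ?g ((t + pnorm 0 y) / a)"
    using assms pnorm_upper[of 0 0 y "(t - pnorm 0 y) / a"] pnorm_upper[of 0 0 y "(t + pnorm 0 y) / a"]
    by (auto simp: abs_le_iff)
  ultimately have "t \<in> range ?g"
    using connectedD_interval by blast
  then show ?thesis
    using that by auto
qed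

text \<open>A wave of frequency \<open>w\<close> and amplitude of size \<open>w\<close> to the power
  \<open>-m\<close> stays bounded in \<open>p_m\<close>, while its derivative of order
  \<open>m + 1\<close> grows like \<open>w\<close>. The condition \<open>1 \<le> m\<close> makes the
  amplitude itself tend to 0.\<close>

lemma compose_perturbation_unbounded:
  assumes \<phi>: "smooth \<phi>" "periodic1 \<phi>" and t0: "deriv \<phi> t0 \<noteq> 0" and "a \<noteq> 0"
    and "0 < e" "1 \<le> m"
  obtains z s where "pnorm m z < e"
    "K < \<bar>(deriv ^^ Suc m) (\<lambda>s. \<phi> (a * s + ev (x + z) s)) s\<bar>"
proof -
  obtain s0 where s0: "a * s0 + ev x s0 = t0"
    using linear_plus_ev_surj[OF \<open>a \<noteq> 0\<close>] .
  \<comment> \<open>Half of the value at \<open>t0\<close>, so that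
    \<open>\<bar>deriv \<phi>\<bar>\<close> is at least \<open>b\<close> near
    \<open>t0\<close>.\<close>
  define b where "b = \<bar>deriv \<phi> t0\<bar> / 2"
  have "0 < b"
    using t0 by (simp add: b_def)
  have "isCont (deriv \<phi>) t0"
    using smooth_DERIV[OF smooth_deriv[OF \<phi>(1)]] by (rule DERIV_isCont)
  then obtain r where "0 < r" and r: "\<And>t. \<bar>t - t0\<bar> < r \<Longrightarrow> \<bar>deriv \<phi> t - deriv \<phi> t0\<bar> < b"
    using \<open>0 < b\<close> unfolding continuous_at_eps_delta dist_real_def by metis
  \<comment> \<open>The bound on the derivatives covers every \<open>z\<close> with
    \<open>pnorm m z < e\<close>, so \<open>B\<close> is fixed before the frequency is
    chosen.\<close>
  obtain B where B: "\<And>g s. smooth g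
      \<Longrightarrow> (\<And>l. 1 \<le> l \<Longrightarrow> l \<le> m \<Longrightarrow> \<bar>(deriv ^^ l) g s\<bar> \<le> \<bar>a\<bar> + pnorm m x + e)
      \<Longrightarrow> \<bar>(deriv ^^ Suc m) (\<lambda>s. \<phi> (g s)) s - deriv \<phi> (g s) * (deriv ^^ Suc m) g s\<bar> \<le> B"
    using higher_deriv_compose_leading_term[OF \<phi>, where m = m and M = "\<bar>a\<bar> + pnorm m x + e"] by metis
  define X where "X = \<bar>a\<bar> + pnorm (Suc m) x"
  \<comment> \<open>The three summands serve to make powers of \<open>w\<close> monotone, to keep
    the argument of \<open>deriv \<phi>\<close> within \<open>r\<close> of \<open>t0\<close>, and to
    let the top derivative outweigh \<open>X\<close>, \<open>B\<close> and \<open>K\<close>.\<close>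
  obtain N :: nat where N: "1 + \<bar>e / r\<bar> + \<bar>2 / e * ((\<bar>K\<bar> + \<bar>B\<bar>) / b + X)\<bar> < real N"
    using reals_Archimedean2 by blast
  define w where "w = 2 * pi * real N"
  have "real N \<le> w"
    using pi_gt3 mult_right_mono[of 1 "2 * pi" "real N"] by (simp add: w_def)
  then have w: "1 \<le> w" "e / r < w" "2 / e * ((\<bar>K\<bar> + \<bar>B\<bar>) / b + X) < w"
    using N by linarith+
  \<comment> \<open>Normalised so that \<open>A * w ^ m\<close>, the bound for
    \<open>pnorm m z\<close>, equals \<open>e / 2\<close>.\<close>
  define A where "A = e / 2 / w ^ m"
  have A: "0 \<le> A" "A * w ^ m = e / 2"
    using w \<open>0 < e\<close> by (auto simp: A_def)
  \<comment> \<open>the phase puts a maximum of the derivative of order \<open>m + 1\<close> at \<open>s0\<close>\<close>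
  define z where "z = wave A N (pi / 2 - w * s0 - real (Suc m) * (pi / 2))"
  have z_small: "pnorm m z \<le> e / 2"
    using pnorm_wave_le[OF A(1)] w A(2) by (metis w_def z_def)
  have z_large: "(deriv ^^ Suc m) (ev z) s0 = e / 2 * w"
  proof -
    have "(deriv ^^ Suc m) (ev z) s0 = A * w ^ Suc m * sin (pi / 2)"
      unfolding z_def higher_deriv_ev_wave w_def by (simp add: algebra_simps)
    then show ?thesis
      using A(2) by simp
  qed
  let ?g = "\<lambda>s. a * s + ev (x + z) s"
  have near: "\<bar>?g s0 - t0\<bar> < r"
  proof -
    have "w \<le> w ^ m"
      using power_increasing[OF \<open>1 \<le> m\<close> w(1)] by simp
    then have "A \<le> e / 2 / w"
      unfolding A_def using w \<open>0 < e\<close> by (intro divide_left_mono) auto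
    moreover have "e / 2 / w < r"
      using w \<open>0 < r\<close> \<open>0 < e\<close> by (simp add: field_simps)
    moreover have "\<bar>ev z s0\<bar> \<le> A"
      using abs_higher_deriv_ev_wave_le[OF A(1), of 0] by (simp add: z_def)
    ultimately show ?thesis
      using s0 by (simp add: plus_smooth_per.rep_eq)
  qed
  have "b \<le> \<bar>deriv \<phi> (?g s0)\<bar>"
    using r[OF near] unfolding b_def by linarith
  moreover have top: "e / 2 * w - X \<le> \<bar>(deriv ^^ Suc m) ?g s0\<bar>"
    using higher_deriv_linear_plus_ev[of "Suc m" a "x + z" s0] z_large
      pnorm_upper[of "Suc m" "Suc m" x s0]
    unfolding higher_deriv_ev_add X_def by linarith
  moreover have large: "(\<bar>K\<bar> + \<bar>B\<bar>) / b < e / 2 * w - X"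
    using w(3) \<open>0 < e\<close> by (simp add: field_simps)
  \<comment> \<open>The leading term exceeds \<open>\<bar>K\<bar> + \<bar>B\<bar>\<close>, and the
    remainder takes away at most \<open>B\<close>.\<close>
  ultimately have "b * ((\<bar>K\<bar> + \<bar>B\<bar>) / b) < \<bar>deriv \<phi> (?g s0)\<bar> * \<bar>(deriv ^^ Suc m) ?g s0\<bar>"
    using \<open>0 < b\<close> by (intro mult_le_less_imp_less) auto
  then have "\<bar>K\<bar> + \<bar>B\<bar> < \<bar>deriv \<phi> (?g s0) * (deriv ^^ Suc m) ?g s0\<bar>"
    using \<open>0 < b\<close> by (simp add: abs_mult)
  moreover have "\<bar>(deriv ^^ Suc m) (\<lambda>s. \<phi> (?g s)) s0 - deriv \<phi> (?g s0) * (deriv ^^ Suc m) ?g s0\<bar> \<le> B"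
  proof (rule B[OF smooth_linear_plus_ev])
    fix l assume l: "1 \<le> l" "l \<le> m"
    show "\<bar>(deriv ^^ l) ?g s0\<bar> \<le> \<bar>a\<bar> + pnorm m x + e"
      using higher_deriv_linear_plus_ev[OF l(1), of a "x + z" s0] z_small \<open>0 < e\<close>
        pnorm_upper[OF l(2), of x s0] pnorm_upper[OF l(2), of z s0]
      unfolding higher_deriv_ev_add by linarith
  qed
  ultimately have "K < \<bar>(deriv ^^ Suc m) (\<lambda>s. \<phi> (?g s)) s0\<bar>"
    by linarith
  then show ?thesis
    using z_small \<open>0 < e\<close> that[of z s0] by linarith
qed

text \<open>Adding a constant leaves \<open>deriv (ev y)\<close> unchanged and only shifts the
  argument of \<open>\<phi>\<close>. The factor \<open>a + deriv (ev y) s\<close> is then exactly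
  the inner derivative in the chain rule.\<close>

lemma ev_dir_deriv_const:
  assumes "smooth \<phi>"
    and f: "\<And>x s. x \<in> D \<Longrightarrow> ev (f x) s = \<phi> (a * s + ev x s) * (a + deriv (ev x) s)"
    and diff: "directionally_differentiable D f" and "y \<in> D"
  shows "ev (dir_deriv D f y (const_per c)) s = c * deriv (\<lambda>s. \<phi> (a * s + ev y s)) s"
proof -
  let ?u = "const_per c" and ?t = "a * s + ev y s"
  obtain d where d: "has_dir_deriv D f y ?u d"
    using diff \<open>y \<in> D\<close> unfolding directionally_differentiable_def by blast
  have ev_deriv: "deriv (ev (y + t *\<^sub>R ?u)) s = deriv (ev y) s" for t
  proof -
    have "ev (y + t *\<^sub>R ?u) = (\<lambda>s. ev y s + t * c)"
      by (simp add: plus_smooth_per.rep_eq scaleR_smooth_per.rep_eq const_per.rep_eq)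
    then show ?thesis
      by (auto intro!: DERIV_imp_deriv derivative_eq_intros smooth_DERIV smooth_ev)
  qed
  have "((\<lambda>t. ev (inverse t *\<^sub>R (f (y + t *\<^sub>R ?u) - f y)) s) \<longlongrightarrow> ev d s) (at 0)"
    using d unfolding has_dir_deriv_def by (intro tendsto_ev) blast
  \<comment> \<open>Only for small \<open>t\<close>, since the formula for \<open>f\<close> is
    available on \<open>D\<close> alone.\<close>
  moreover have "\<forall>\<^sub>F t in at 0. ev (inverse t *\<^sub>R (f (y + t *\<^sub>R ?u) - f y)) s
      = (\<phi> (?t + t * c) - \<phi> ?t) / t * (a + deriv (ev y) s)"
  proof -
    have "\<forall>\<^sub>F t in at 0. y + t *\<^sub>R ?u \<in> D"
      using d by (simp add: has_dir_deriv_def)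
    then show ?thesis
    proof eventually_elim
      case (elim t)
      have "ev (f (y + t *\<^sub>R ?u)) s = \<phi> (?t + t * c) * (a + deriv (ev y) s)"
        unfolding f[OF elim] ev_deriv
        by (simp add: scaleR_smooth_per.rep_eq plus_smooth_per.rep_eq const_per.rep_eq algebra_simps)
      then show ?case
        by (simp add: scaleR_smooth_per.rep_eq minus_smooth_per.rep_eq f[OF \<open>y \<in> D\<close>]
            divide_inverse algebra_simps)
    qed
  qed
  ultimately have "((\<lambda>t. (\<phi> (?t + t * c) - \<phi> ?t) / t * (a + deriv (ev y) s)) \<longlongrightarrow> ev d s) (at 0)"
    by (rule Lim_transform_eventually)
  moreover have "((\<lambda>t. \<phi> (?t + t * c)) has_field_derivative deriv \<phi> ?t * c) (at 0)"
    by (rule DERIV_chain2[where f = \<phi>])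
      (auto intro!: derivative_eq_intros smooth_DERIV[OF assms(1)])
  then have "((\<lambda>t. (\<phi> (?t + t * c) - \<phi> ?t) / t) \<longlongrightarrow> deriv \<phi> ?t * c) (at 0)"
    by (simp add: DERIV_def)
  then have "((\<lambda>t. (\<phi> (?t + t * c) - \<phi> ?t) / t * (a + deriv (ev y) s))
      \<longlongrightarrow> deriv \<phi> ?t * c * (a + deriv (ev y) s)) (at 0)"
    by (rule tendsto_mult_right)
  ultimately have "ev d s = deriv \<phi> ?t * c * (a + deriv (ev y) s)"
    by (rule tendsto_unique[OF trivial_limit_at])
  moreover have "deriv (\<lambda>s. \<phi> (a * s + ev y s)) s = deriv \<phi> ?t * (a + deriv (ev y) s)"
    by (intro DERIV_imp_deriv DERIV_chain2[where f = \<phi>] smooth_DERIV[OF assms(1)])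
      (auto intro!: derivative_eq_intros smooth_DERIV[OF smooth_ev])
  ultimately show ?thesis
    by (simp add: dir_deriv_eq[OF d])
qed

theorem proposition3:
  fixes \<phi> :: "real \<Rightarrow> real" and n :: int and f :: "smooth_per \<Rightarrow> smooth_per"
  assumes "smooth \<phi>" and "periodic1 \<phi>" and "n \<noteq> 0"
    and "\<And>x s. x \<in> Udom n \<Longrightarrow>
           ev (f x) s = \<phi> (of_int n * s + ev x s) * (of_int n + deriv (ev x) s)"
    and "\<exists>x. almost_M_tame_at (Udom n) f x"
  shows "\<exists>c. range \<phi> = {c}"
proof -
  obtain x \<rho>1 \<rho>2 where diff: "directionally_differentiable (Udom n) f"
    and P: "P_norm \<rho>1" "P_norm \<rho>2"
    and dom: "\<And>z. \<rho>1 z \<le> 1 \<Longrightarrow> x + z \<in> Udom n"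
    and tame: "\<And>z u. \<rho>1 z \<le> 1
      \<Longrightarrow> \<rho>2 (dir_deriv (Udom n) f (x + z) u - dir_deriv (Udom n) f x u) \<le> \<rho>1 u"
    using assms(5) unfolding almost_M_tame_at_def by blast
  obtain i e where "0 < e" and e: "\<And>z. pnorm i z < e \<Longrightarrow> \<rho>1 z < 1"
    using P_norm_small_if_pnorm_small[OF P(1) zero_less_one] by metis
  \<comment> \<open>Passing from \<open>i\<close> to \<open>Suc i\<close> ensures
    \<open>1 \<le> m\<close> and only shrinks the ball, by monotonicity of the norms.\<close>
  define m where "m = Suc i"
  have e_m: "\<rho>1 z \<le> 1" if "pnorm m z < e" for z
    using e[of z] that pnorm_mono[of i m z] by (simp add: m_def)
  have "x \<in> Udom n"
    using dom[of 0] e_m[of 0] \<open>0 < e\<close> by (simp add: pnorm_zero)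
  \<comment> \<open>The order in the target is free. Order \<open>m\<close> is taken because the
    directional derivative already contains one derivative of \<open>?h y\<close>, which yields
    control of order \<open>m + 1\<close>.\<close>
  obtain d where "0 < d" and d: "\<And>w. \<rho>2 w < d \<Longrightarrow> pnorm m w < 1"
    using pnorm_small_if_P_norm_small[OF P(2) zero_less_one] by metis
  obtain k r where "0 < r" and r: "\<And>z. pnorm k z < r \<Longrightarrow> \<rho>1 z < d"
    using P_norm_small_if_pnorm_small[OF P(1) \<open>0 < d\<close>] by metis
  \<comment> \<open>A nonzero constant below \<open>r\<close> in \<open>p_k\<close>, whatever
    \<open>k\<close> is, so that \<open>\<rho>1 (const_per c) < d\<close>.\<close>
  define c where "c = r / 2"
  have "0 < c"
    using \<open>0 < r\<close> by (simp add: c_def)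
  have c: "\<rho>1 (const_per c) < d"
    using r[of "const_per c"] pnorm_const_per[of k c] \<open>0 < r\<close> by (simp add: c_def)
  let ?h = "\<lambda>y s. \<phi> (of_int n * s + ev y s)" and ?\<delta> = "\<lambda>y. dir_deriv (Udom n) f y (const_per c)"
  have \<delta>: "(deriv ^^ m) (ev (?\<delta> y)) s = c * (deriv ^^ Suc m) (?h y) s" if "y \<in> Udom n" for y s
  proof -
    have h: "smooth (deriv (?h y))"
      by (rule smooth_deriv[OF smooth_compose[OF smooth_linear_plus_ev assms(1)]])
    have "ev (?\<delta> y) = (\<lambda>s. c * deriv (?h y) s)"
      using ev_dir_deriv_const[OF assms(1,4) diff that] by blast
    then show ?thesis
      using fun_cong[OF higher_deriv_lincomb[OF h h, of m c 0], of s]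
      by (simp add: higher_deriv_deriv)
  qed
  \<comment> \<open>The right-hand side depends on neither \<open>z\<close> nor \<open>s\<close>.
    Tameness in the direction \<open>const_per c\<close> keeps \<open>?\<delta> (x + z)\<close>
    within distance 1 of \<open>?\<delta> x\<close> in \<open>p_m\<close>.\<close>
  have bound: "\<bar>(deriv ^^ Suc m) (?h (x + z)) s\<bar> \<le> (1 + pnorm m (?\<delta> x)) / c" if "pnorm m z < e" for z s
  proof -
    have "pnorm m (?\<delta> (x + z) - ?\<delta> x) < 1"
      using d tame[OF e_m[OF that], of "const_per c"] c by simp
    then have "pnorm m (?\<delta> (x + z)) \<le> 1 + pnorm m (?\<delta> x)"
      using pnorm_triangle[of m "?\<delta> (x + z) - ?\<delta> x" "?\<delta> x"] by simp
    moreover have "c * \<bar>(deriv ^^ Suc m) (?h (x + z)) s\<bar> \<le> pnorm m (?\<delta> (x + z))"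
      using pnorm_upper[of m m "?\<delta> (x + z)" s] \<open>0 < c\<close>
      unfolding \<delta>[OF dom[OF e_m[OF that]]] abs_mult by simp
    ultimately show ?thesis
      using \<open>0 < c\<close> by (simp add: pos_le_divide_eq mult.commute del: funpow.simps)
  qed
  have "deriv \<phi> t = 0" for t
  proof (rule ccontr)
    assume "deriv \<phi> t \<noteq> 0"
    moreover have "real_of_int n \<noteq> 0" "1 \<le> m"
      using assms(3) by (auto simp: m_def)
    \<comment> \<open>The uniform bound itself serves as the threshold \<open>K\<close> to be
      exceeded on the same ball.\<close>
    ultimately obtain z s where "pnorm m z < e"
      "(1 + pnorm m (?\<delta> x)) / c < \<bar>(deriv ^^ Suc m) (?h (x + z)) s\<bar>"
      using compose_perturbation_unbounded[OF assms(1,2) _ _ \<open>0 < e\<close>] by metis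
    then show False
      using bound by (meson not_le)
  qed
  then have "\<phi> s = \<phi> 0" for s
    using smooth_DERIV[OF assms(1)] DERIV_isconst_all[of \<phi> s 0] by metis
  then show ?thesis
    by (intro exI[of _ "\<phi> 0"]) auto
qed

end
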